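(* Let $G$ be a transitive group of permutations of the finite set $\Omega$. Let $\sigma$ be a permutation of $\Omega$ of order $2$ which fixes exactly one element $\omega\in\Omega$, and which normalizes $G$, that is $G^\sigma=G$. Let $G_\omega$ be the stabilizer of $\omega$ in $G$. Then $M^\sigma=M$ for each group $M$ with $G_\omega\le M\le G$.
   Context: $G$ is a subgroup of the symmetric group on $\Omega$. For a subset or subgroup $S$ of the symmetric group on $\Omega$ and a permutation $h$ of $\Omega$, $S^h=\{h^{-1}sh\mid s\in S\}$. The stabilizer $G_\omega$ is the subgroup of all $g\in G$ fixing $\omega$. *)

theory Defs
  imports "HOL-Algebra.Algebra"
begin

text \<open>
  Permutations of \<open>\<Omega>\<close> are the elements of \<open>BijGroup \<Omega>\<close>, i.e. bijections of \<open>\<Omega>\<close> that are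
  \<open>undefined\<close> outside \<open>\<Omega>\<close>. The product there is \<open>f \<otimes> g = (\<lambda>x\<in>\<Omega>. f (g x))\<close>, the opposite of
  the right-action convention; as a result the definition below, read with right actions,
  yields \<open>S\<close> conjugated by \<open>h\<inverse>\<close>. For \<open>h\<close> of order 2 the two conventions agree.
\<close>

definition conj_set :: "('g, 'm) monoid_scheme \<Rightarrow> 'g set \<Rightarrow> 'g \<Rightarrow> 'g set"
  where "conj_set H S h = {inv\<^bsub>H\<^esub> h \<otimes>\<^bsub>H\<^esub> s \<otimes>\<^bsub>H\<^esub> h | s. s \<in> S}"

abbreviation perm_group :: "'a set \<Rightarrow> ('a \<Rightarrow> 'a) set \<Rightarrow> ('a \<Rightarrow> 'a) monoid"
  where "perm_group \<Omega> G \<equiv> (BijGroup \<Omega>)\<lparr>carrier := G\<rparr>"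

end

theory Submission
  imports Defs
begin

text \<open>
  Conjugation by \<open>\<sigma>\<close> inverts every \<open>\<rho> = \<sigma> g \<sigma> g\<inverse>\<close>, and \<open>\<rho>\<close> lies in \<open>G\<close> because
  \<open>\<sigma>\<close> normalizes \<open>G\<close>. The permutations \<open>\<sigma>\<close> and \<open>\<tau> = g \<sigma> g\<inverse>\<close> generate a dihedral group
  with rotation \<open>\<rho> = \<sigma> \<tau>\<close>, and \<open>\<tau>\<close> fixes \<open>g \<omega>\<close> only. The \<open>\<rho>\<close>-cycle through \<open>\<omega>\<close> is a
  polygon on which \<open>\<sigma>\<close> acts as a reflection. An even polygon would have a second vertex fixed by
  \<open>\<sigma>\<close>, so the polygon is odd, and the reflection \<open>\<tau>\<close> then fixes one of its vertices, which must be
  \<open>g \<omega>\<close>. Hence some power \<open>r\<close> of \<open>\<rho>\<close> takes \<open>\<omega>\<close> to \<open>g \<omega>\<close>: each coset \<open>g G\<^sub>\<omega>\<close> with \<open>g \<in> G\<close> contains an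
  element of \<open>G\<close> that \<open>\<sigma>\<close> inverts (\<open>coset_contains_inverted_power\<close>).

  Now let \<open>m \<in> M\<close> and write \<open>m = r h\<close> with such an \<open>r\<close> and \<open>h \<in> G\<^sub>\<omega> \<le> M\<close>. Then \<open>r = m h\<inverse> \<in> M\<close>, and
  \<open>\<sigma> m \<sigma> = r\<inverse> (\<sigma> h \<sigma>)\<close>. As \<open>\<sigma>\<close> fixes \<open>\<omega>\<close> and normalizes \<open>G\<close>, the second factor is in
  \<open>G\<^sub>\<omega>\<close>, so that \<open>\<sigma> m \<sigma> \<in> M\<close> (\<open>overgroup_closed_under_conjugation\<close>).
\<close>

lemma (in group) conj_nat_pow_of_inverted:
  assumes "s \<in> carrier G" "r \<in> carrier G" "s \<otimes> s = \<one>" "s \<otimes> r \<otimes> s = inv r"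
  shows "s \<otimes> r [^] (n::nat) = inv (r [^] n) \<otimes> s"
proof (induction n)
  case 0
  then show ?case using assms by simp
next
  case (Suc n)
  have sr: "s \<otimes> r = inv r \<otimes> s"
    using assms by (metis inv_closed m_assoc m_closed r_one)
  have "s \<otimes> r [^] Suc n = (s \<otimes> r [^] n) \<otimes> r"
    using assms by (simp add: m_assoc)
  also have "\<dots> = inv (r [^] n) \<otimes> (s \<otimes> r)"
    using assms by (simp add: Suc.IH m_assoc)
  also have "\<dots> = inv (r [^] n) \<otimes> inv r \<otimes> s"
    using assms by (simp add: sr m_assoc)
  also have "inv (r [^] n) \<otimes> inv r = inv (r [^] Suc n)"
    using assms by (metis inv_mult_group nat_pow_Suc2 nat_pow_closed)
  finally show ?case .
qed

context group_action
begin

interpretation group G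
  using group_hom group_hom.axioms(1) by auto

lemma exists_period:
  assumes "finite E" "x \<in> E" "r \<in> carrier G"
  shows "\<exists>n>0. \<phi> (r [^] (n::nat)) x = x"
proof -
  have "range (\<lambda>n::nat. \<phi> (r [^] n) x) \<subseteq> E"
    using assms by (auto intro: element_image)
  then have "\<not> inj (\<lambda>n::nat. \<phi> (r [^] n) x)"
    using assms(1) finite_subset range_inj_infinite by blast
  then obtain i j :: nat where ij: "i < j" "\<phi> (r [^] i) x = \<phi> (r [^] j) x"
    by (metis linorder_injI)
  have "\<phi> (r [^] i) (\<phi> (r [^] (j - i)) x) = \<phi> (r [^] i) x"
    using ij assms by (simp add: composition_rule [symmetric] nat_pow_mult)
  then have "\<phi> (r [^] (j - i)) x = x"
    using assms by (meson element_image inj_on_eq_iff inj_prop nat_pow_closed)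
  with ij show ?thesis by (intro exI [of _ "j - i"]) simp
qed

text \<open>
  If the period is even, the point half way round the cycle is fixed by \<open>s\<close>, hence equals \<open>x\<close>;
  so a period can be halved until it is odd.
\<close>

lemma exists_odd_period:
  assumes "finite E" and s: "s \<in> carrier G" "s \<otimes> s = \<one>" "invariants E \<phi> s = {x}"
    and r: "r \<in> carrier G" "s \<otimes> r \<otimes> s = inv r"
  shows "\<exists>i. \<phi> (r [^] (2 * i + 1 :: nat)) x = x"
proof -
  have x: "x \<in> E" "\<phi> s x = x" and unique: "\<And>y. y \<in> E \<Longrightarrow> \<phi> s y = y \<Longrightarrow> y = x"
    using s(3) by (auto simp: invariants_def)
  have halve: "\<phi> (r [^] j) x = x" if "\<phi> (r [^] (2 * j)) x = x" for j :: nat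
  proof (rule unique)
    show "\<phi> (r [^] j) x \<in> E"
      using r x by (auto intro: element_image)
    have "\<phi> s (\<phi> (r [^] j) x) = \<phi> (inv (r [^] j)) x"
      using r s x conj_nat_pow_of_inverted [OF s(1) r(1) s(2) r(2)]
      by (simp add: composition_rule [symmetric]) (simp add: composition_rule)
    also have "\<dots> = \<phi> (inv (r [^] j)) (\<phi> (r [^] j \<otimes> r [^] j) x)"
      using that r by (simp add: nat_pow_mult mult_2)
    also have "\<dots> = \<phi> (r [^] j) x"
      using r x by (simp add: composition_rule [symmetric] m_assoc [symmetric])
    finally show "\<phi> s (\<phi> (r [^] j) x) = \<phi> (r [^] j) x" .
  qed
  have "\<exists>i. \<phi> (r [^] (2 * i + 1 :: nat)) x = x" if "n > 0" "\<phi> (r [^] n) x = x" for n :: nat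
    using that
  proof (induction n rule: less_induct)
    case (less n)
    show ?case
    proof (cases "even n")
      case True
      then obtain j where "n = 2 * j" by blast
      with less halve show ?thesis by (metis nat_0_less_mult_iff less_add_same_cancel1 mult_2)
    next
      case False
      with less show ?thesis by (metis oddE)
    qed
  qed
  with exists_period [OF assms(1) x(1) r(1)] show ?thesis by blast
qed

text \<open>
  Let \<open>2 i + 1\<close> be a period of \<open>x\<close> under \<open>\<rho> = s g s g\<inverse>\<close>. The reflection \<open>g s g\<inverse> = s \<rho>\<close> maps
  \<open>\<rho>\<^sup>i x\<close> to \<open>(\<rho>\<^sup>i\<^sup>+\<^sup>1)\<inverse> x\<close>, which by the choice of \<open>i\<close> is \<open>\<rho>\<^sup>i x\<close> again. But the only fixed point
  of this reflection is \<open>g x\<close>.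
\<close>

lemma coset_contains_inverted_power:
  assumes "finite E" and s: "s \<in> carrier G" "s \<otimes> s = \<one>" "invariants E \<phi> s = {x}"
    and g: "g \<in> carrier G"
  shows "\<exists>i::nat. \<phi> ((s \<otimes> g \<otimes> s \<otimes> inv g) [^] i) x = \<phi> g x"
proof -
  define r where "r = s \<otimes> g \<otimes> s \<otimes> inv g"
  have r: "r \<in> carrier G" using s g by (simp add: r_def)
  have ss: "s \<otimes> (s \<otimes> a) = a" if "a \<in> carrier G" for a
    using that s by (simp add: m_assoc [symmetric])
  have sr: "s \<otimes> r = g \<otimes> s \<otimes> inv g"
    using s g by (simp add: r_def m_assoc ss)
  have inv_s: "inv s = s"
    using s inv_equality by blast
  have inverted: "s \<otimes> r \<otimes> s = inv r"
    using s g by (simp add: sr r_def inv_mult_group inv_s m_assoc ss)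
  have x: "x \<in> E" "\<phi> s x = x" and unique: "\<And>y. y \<in> E \<Longrightarrow> \<phi> s y = y \<Longrightarrow> y = x"
    using s(3) by (auto simp: invariants_def)
  obtain i :: nat where i: "\<phi> (r [^] (2 * i + 1)) x = x"
    using exists_odd_period [OF assms(1) s r inverted] by blast
  define y where "y = \<phi> (r [^] i) x"
  have y: "y \<in> E" using r x by (auto simp: y_def intro: element_image)
  have cancel: "\<phi> (inv a) (\<phi> (a \<otimes> b) x) = \<phi> b x" if "a \<in> carrier G" "b \<in> carrier G" for a b
    using that x by (simp add: composition_rule [symmetric] m_assoc [symmetric])
  have "\<phi> (s \<otimes> r) y = \<phi> (s \<otimes> r \<otimes> r [^] i) x"
    using s r x by (simp add: y_def composition_rule)
  also have "s \<otimes> r \<otimes> r [^] i = s \<otimes> r [^] Suc i"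
    using s r by (metis m_assoc nat_pow_Suc2 nat_pow_closed)
  also have "\<phi> (s \<otimes> r [^] Suc i) x = \<phi> (inv (r [^] Suc i)) x"
    using s r x conj_nat_pow_of_inverted [OF s(1) r s(2) inverted, of "Suc i"]
    by (simp del: nat_pow_Suc add: composition_rule)
  also have "\<dots> = \<phi> (inv (r [^] Suc i)) (\<phi> (r [^] Suc i \<otimes> r [^] i) x)"
    using i nat_pow_mult [OF r, of "Suc i" i] by (simp del: nat_pow_Suc add: mult_2)
  also have "\<dots> = y"
    using cancel [of "r [^] Suc i" "r [^] i"] r unfolding y_def by blast
  finally have fixed: "\<phi> (g \<otimes> s \<otimes> inv g) y = y"
    by (simp add: sr)
  have "\<phi> s (\<phi> (inv g) y) = \<phi> (inv g) (\<phi> (g \<otimes> s \<otimes> inv g) y)"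
    using s g y by (simp add: composition_rule [symmetric] m_assoc [symmetric])
  with fixed have "\<phi> s (\<phi> (inv g) y) = \<phi> (inv g) y" by simp
  moreover have "\<phi> (inv g) y \<in> E"
    using g y by (auto intro: element_image)
  ultimately have "\<phi> (inv g) y = x" by (rule unique [rotated])
  then have "\<phi> g x = y"
    using orbit_sym_aux [of "inv g" y x] g y by simp
  then show ?thesis
    unfolding y_def r_def by metis
qed

lemma overgroup_closed_under_conjugation:
  assumes "finite E" and s: "s \<in> carrier G" "s \<otimes> s = \<one>" "invariants E \<phi> s = {x}"
    and H: "subgroup H G" and norm: "\<And>h. h \<in> H \<Longrightarrow> s \<otimes> h \<otimes> s \<in> H"
    and M: "subgroup M G" "stabilizer (G\<lparr>carrier := H\<rparr>) \<phi> x \<subseteq> M" "M \<subseteq> H"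
    and m: "m \<in> M"
  shows "s \<otimes> m \<otimes> s \<in> M"
proof -
  interpret H: subgroup H G by (fact H)
  interpret M: subgroup M G by (fact M(1))
  have x: "x \<in> E" "\<phi> s x = x" using s(3) by (auto simp: invariants_def)
  have stab: "h \<in> M" if "h \<in> H" "\<phi> h x = x" for h
    using that M(2) by (auto simp: stabilizer_def)
  define \<rho> where "\<rho> = s \<otimes> m \<otimes> s \<otimes> inv m"
  have \<rho>: "\<rho> \<in> H" using norm m M(3) by (auto simp: \<rho>_def)
  obtain i :: nat where i: "\<phi> (\<rho> [^] i) x = \<phi> m x"
    using coset_contains_inverted_power [OF assms(1) s M.mem_carrier [OF m]]
    unfolding \<rho>_def by blast
  define r where "r = \<rho> [^] i"
  have r: "r \<in> H" unfolding r_def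
    using \<rho> by (induction i) auto
  have mG: "m \<in> carrier G" "m \<in> H" and rG: "r \<in> carrier G" using m M(3) r by auto
  have ss: "s \<otimes> (s \<otimes> a) = a" if "a \<in> carrier G" for a
    using that s by (simp add: m_assoc [symmetric])
  have inv_s: "inv s = s"
    using s inv_equality by blast
  have inverted: "s \<otimes> \<rho> \<otimes> s = inv \<rho>"
    using s mG by (simp add: \<rho>_def inv_mult_group inv_s m_assoc ss)
  have srs: "s \<otimes> r \<otimes> s = inv r"
    using conj_nat_pow_of_inverted [OF s(1) _ s(2) inverted, of i] \<rho> s
    by (simp add: r_def m_assoc)
  define h where "h = inv r \<otimes> m"
  have h: "h \<in> H" using r mG by (simp add: h_def)
  have hG: "h \<in> carrier G" using h by auto
  have hx: "\<phi> h x = x"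
    using i r x mG orbit_sym_aux [of r x] by (simp add: h_def r_def composition_rule)
  have "\<phi> (s \<otimes> h \<otimes> s) x = x"
    using s x hG hx by (simp add: composition_rule)
  with h norm have shs: "s \<otimes> h \<otimes> s \<in> M" by (intro stab)
  have "r = m \<otimes> inv h"
    using mG rG by (simp add: h_def inv_mult_group m_assoc [symmetric])
  then have "r \<in> M" using m stab [OF h hx] by simp
  moreover have "s \<otimes> m \<otimes> s = inv r \<otimes> (s \<otimes> h \<otimes> s)"
  proof -
    have "inv r \<otimes> (s \<otimes> h \<otimes> s) = s \<otimes> (r \<otimes> h) \<otimes> s"
      using s rG hG by (simp add: srs [symmetric] m_assoc ss)
    also have "r \<otimes> h = m"
      using rG mG by (simp add: h_def m_assoc [symmetric])
    finally show ?thesis ..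
  qed
  ultimately show ?thesis using shs by simp
qed

end

theorem proposition1p6:
  fixes \<Omega> :: "'a set" and G :: "('a \<Rightarrow> 'a) set" and \<sigma> :: "'a \<Rightarrow> 'a" and \<omega> :: 'a
  assumes "finite \<Omega>"
    and "subgroup G (BijGroup \<Omega>)"
    and "transitive_action (perm_group \<Omega> G) \<Omega> (\<lambda>g. g)"
    and "\<sigma> \<in> carrier (BijGroup \<Omega>)"
    and "group.ord (BijGroup \<Omega>) \<sigma> = 2"
    and "invariants \<Omega> (\<lambda>g. g) \<sigma> = {\<omega>}"
    and "conj_set (BijGroup \<Omega>) G \<sigma> = G"
  shows "\<forall>M. subgroup M (BijGroup \<Omega>) \<and> stabilizer (perm_group \<Omega> G) (\<lambda>g. g) \<omega> \<subseteq> M \<and> M \<subseteq> G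
    \<longrightarrow> conj_set (BijGroup \<Omega>) M \<sigma> = M"
proof (intro allI impI)
  fix M
  assume M: "subgroup M (BijGroup \<Omega>) \<and> stabilizer (perm_group \<Omega> G) (\<lambda>g. g) \<omega> \<subseteq> M \<and> M \<subseteq> G"
  interpret S: group "BijGroup \<Omega>" by (rule group_BijGroup)
  interpret group_action "BijGroup \<Omega>" \<Omega> "\<lambda>g. g"
    by unfold_locales (simp add: hom_def)
  interpret M: subgroup M "BijGroup \<Omega>" using M by blast
  note \<sigma> = assms(4)
  have sq: "\<sigma> \<otimes>\<^bsub>BijGroup \<Omega>\<^esub> \<sigma> = \<one>\<^bsub>BijGroup \<Omega>\<^esub>"
    using S.pow_ord_eq_1 [OF \<sigma>] \<sigma> by (simp add: assms(5) numeral_2_eq_2)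
  have inv_\<sigma>: "inv\<^bsub>BijGroup \<Omega>\<^esub> \<sigma> = \<sigma>"
    using S.inv_equality [OF sq \<sigma> \<sigma>] .
  have norm: "\<sigma> \<otimes>\<^bsub>BijGroup \<Omega>\<^esub> g \<otimes>\<^bsub>BijGroup \<Omega>\<^esub> \<sigma> \<in> G" if "g \<in> G" for g
    using assms(7) that by (auto simp: conj_set_def inv_\<sigma>)
  have closed: "\<sigma> \<otimes>\<^bsub>BijGroup \<Omega>\<^esub> m \<otimes>\<^bsub>BijGroup \<Omega>\<^esub> \<sigma> \<in> M" if "m \<in> M" for m
    using overgroup_closed_under_conjugation [OF assms(1) \<sigma> sq assms(6,2) norm _ _ _ that] M
    by blast
  show "conj_set (BijGroup \<Omega>) M \<sigma> = M"
  proof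
    show "conj_set (BijGroup \<Omega>) M \<sigma> \<subseteq> M"
      using closed by (auto simp: conj_set_def inv_\<sigma>)
    show "M \<subseteq> conj_set (BijGroup \<Omega>) M \<sigma>"
    proof
      fix m assume m: "m \<in> M"
      then have mS: "m \<in> carrier (BijGroup \<Omega>)" by auto
      let ?n = "\<sigma> \<otimes>\<^bsub>BijGroup \<Omega>\<^esub> m \<otimes>\<^bsub>BijGroup \<Omega>\<^esub> \<sigma>"
      have "\<sigma> \<otimes>\<^bsub>BijGroup \<Omega>\<^esub> ?n \<otimes>\<^bsub>BijGroup \<Omega>\<^esub> \<sigma>
          = (\<sigma> \<otimes>\<^bsub>BijGroup \<Omega>\<^esub> \<sigma>) \<otimes>\<^bsub>BijGroup \<Omega>\<^esub> m \<otimes>\<^bsub>BijGroup \<Omega>\<^esub> (\<sigma> \<otimes>\<^bsub>BijGroup \<Omega>\<^esub> \<sigma>)"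
        using mS \<sigma> by (simp add: S.m_assoc)
      also have "\<dots> = m" using mS by (simp add: sq)
      finally show "m \<in> conj_set (BijGroup \<Omega>) M \<sigma>"
        using closed [OF m] unfolding conj_set_def inv_\<sigma>
        by (metis (mono_tags, lifting) mem_Collect_eq)
    qed
  qed
qed

end
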